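(* Let $n\geq 4$ and let $\mathcal{L}$ be a Cameron-Liebler line class of parameter $x$ in $\mathrm{AG}(n,q)$. Then $x\in\{0,1\}$ or $$x\geq 2\left( \frac{q^{n-1}-1}{q^{2}-1}\right) +1.$$
   Context: For an affine space $\mathrm{AG}(n,q)$, a Cameron-Liebler line class is a set $\mathcal{L}$ of lines whose characteristic vector lies in the row space (over the reals) of the point-line incidence matrix of $\mathrm{AG}(n,q)$; its parameter $x$ is defined by $|\mathcal{L}|=x\frac{q^n-1}{q-1}$. *)

theory Defs
  imports "HOL-Analysis.Analysis"
begin

text \<open>
  The points of AG(n,q) are the vectors of \<^typ>\<open>'a ^ 'n\<close>, where \<open>'a\<close> is a finite field with
  \<open>q = CARD('a)\<close> elements and \<open>n = CARD('n)\<close>. The lines are collected in a finite type, so that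
  they can index the columns of a matrix.
\<close>

definition is_affine_line :: "('a::{field,finite} ^ 'n::finite) set \<Rightarrow> bool" where
  "is_affine_line S \<longleftrightarrow> (\<exists>p d. d \<noteq> 0 \<and> S = {p + t *s d | t. True})"

typedef (overloaded) ('a, 'n) affine_line =
    "{S :: ('a::{field,finite} ^ 'n::finite) set. is_affine_line S}"
  morphisms points_of affine_line_of
proof -
  have "is_affine_line {0 + t *s (1 :: 'a ^ 'n) | t. True}"
    unfolding is_affine_line_def by (intro exI[of _ 0] exI[of _ 1]) simp
  then show ?thesis by blast
qed

instance affine_line :: ("{field,finite}", finite) finite
proof
  show "finite (UNIV :: ('a, 'b) affine_line set)"
    by (rule finite_imageD[of points_of]) (auto intro: finite simp: inj_on_def points_of_inject)
qed

text \<open>Rows are indexed by points, columns by lines.\<close>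

definition incidence_matrix ::
    "real ^ ('a, 'n) affine_line ^ ('a::{field,finite} ^ 'n::finite)" where
  "incidence_matrix = (\<chi> p l. if p \<in> points_of l then 1 else 0)"

definition characteristic_vector :: "'l set \<Rightarrow> real ^ 'l::finite" where
  "characteristic_vector L = (\<chi> l. if l \<in> L then 1 else 0)"

definition cameron_liebler_line_class ::
    "('a::{field,finite}, 'n::finite) affine_line set \<Rightarrow> bool" where
  "cameron_liebler_line_class L \<longleftrightarrow>
     characteristic_vector L \<in> span (rows (incidence_matrix :: real ^ ('a, 'n) affine_line ^ ('a ^ 'n)))"

text \<open>
  The parameter is a real number \<open>x\<close>, determined by \<open>L\<close> through this equation since
  \<open>q \<ge> 2\<close> and \<open>n \<ge> 1\<close>; its integrality is not presupposed.
\<close>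

definition has_parameter ::
    "('a::{field,finite}, 'n::finite) affine_line set \<Rightarrow> real \<Rightarrow> bool" where
  "has_parameter L x \<longleftrightarrow>
     real (card L) = x * ((real CARD('a) ^ CARD('n) - 1) / (real CARD('a) - 1))"

end

(*
  Write the characteristic function of L on lines as l |-> sum of a real function f over the points
  of l, and let F(A) be the sum of f over a flat A. Then x = F(whole space), and for a flat A of
  positive dimension F(A) is the number of lines of L inside A in any given direction of A; so F is
  a nonnegative integer, monotone, and superadditive on disjoint parallel flats. A solid with
  F = 1 has its lines of L all passing through one point P; this forces f(P) = 1 and then x <= 1.
  A solid with F = 2 does not exist. So if x > 1, every solid through a line of L has F >= 3, and
  averaging F first over the solids through a plane, then over the planes through a line of L,
  gives the bound.
*)
theory Submission
  imports Defs
begin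

section \<open>Spans and their sizes over a finite field\<close>

lemma card_field_gt_1: "CARD('a::{field,finite}) > 1"
  using card_mono[of "UNIV :: 'a set" "{0, 1}"] by simp

lemma in_span_insert_subspace:
  fixes S :: "('a::field ^ 'n::finite) set"
  assumes "vec.subspace S"
  shows "w \<in> vec.span (insert v S) \<longleftrightarrow> (\<exists>k. w - k *s v \<in> S)"
  unfolding vec.span_breakdown_eq vec.span_eq_iff[THEN iffD2, OF assms] ..

lemma in_span_singleton: "w \<in> vec.span {v} \<longleftrightarrow> (\<exists>k. w = k *s v)"
  by (auto simp: vec.span_singleton)

lemma in_span_pair:
  fixes v :: "'a::field ^ 'n::finite"
  shows "w \<in> vec.span {v, u} \<longleftrightarrow> (\<exists>s t. w = s *s v + t *s u)"
  unfolding vec.span_breakdown_eq[of w v] in_span_singleton by (simp add: diff_eq_eq add.commute)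

text \<open>Every vector of the span is \<open>k *s v + s\<close> for exactly one scalar
  \<open>k\<close> and one \<open>s\<close> in \<open>S\<close>: two different scalars would put
  \<open>v\<close> into \<open>S\<close>.\<close>

lemma card_span_insert:
  fixes S :: "('a::{field,finite} ^ 'n::finite) set"
  assumes S: "vec.subspace S" and v: "v \<notin> S"
  shows "card (vec.span (insert v S)) = CARD('a) * card S"
proof -
  let ?h = "\<lambda>(k::'a, s). k *s v + s"
  have "inj_on ?h (UNIV \<times> S)"
  proof (rule inj_onI, clarify)
    fix k s l t
    assume st: "s \<in> S" "t \<in> S" and eq: "k *s v + s = l *s v + t"
    have d: "(k - l) *s v = t - s"
      using eq by (simp add: vec.scale_left_diff_distrib algebra_simps)
    have "k = l"
    proof (rule ccontr)
      assume "k \<noteq> l"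
      then have "v = inverse (k - l) *s (t - s)"
        unfolding d[symmetric] by (simp only: vector_smult_assoc) simp
      then have "v \<in> S"
        using S st by (simp add: vec.subspace_scale vec.subspace_diff)
      with v show False ..
    qed
    with eq show "k = l \<and> s = t" by simp
  qed
  moreover have "vec.span (insert v S) = ?h ` (UNIV \<times> S)"
  proof (intro set_eqI iffI)
    fix w assume "w \<in> vec.span (insert v S)"
    then obtain k where "w - k *s v \<in> S" using in_span_insert_subspace[OF S] by auto
    then show "w \<in> ?h ` (UNIV \<times> S)" by (intro image_eqI[of _ _ "(k, w - k *s v)"]) auto
  next
    fix w assume "w \<in> ?h ` (UNIV \<times> S)"
    then obtain k s where "w = k *s v + s" "s \<in> S" by auto
    then show "w \<in> vec.span (insert v S)"
      unfolding in_span_insert_subspace[OF S] by (intro exI[of _ k]) simp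
  qed
  ultimately show ?thesis
    by (simp add: card_image card_cartesian_product)
qed

lemma card_span_singleton:
  fixes v :: "'a::{field,finite} ^ 'n::finite"
  assumes "v \<noteq> 0"
  shows "card (vec.span {v}) = CARD('a)"
  using card_span_insert[of "{0}" v] assms
  by (simp add: vec.subspace_0 insert_commute[of v 0] vec.span_insert_0)

lemma card_span_pair:
  fixes v :: "'a::{field,finite} ^ 'n::finite"
  assumes "v \<noteq> 0" "u \<notin> vec.span {v}"
  shows "card (vec.span {u, v}) = CARD('a) ^ 2"
proof -
  have "vec.span (insert u (vec.span {v})) = vec.span {u, v}"
    by (simp add: set_eq_iff vec.span_breakdown_eq[of _ u] vec.span_span)
  then show ?thesis
    using card_span_insert[of "vec.span {v}" u] assms
    by (simp add: card_span_singleton power2_eq_square)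
qed

lemma span_singleton_eq:
  fixes v :: "'a::field ^ 'n::finite"
  assumes "u \<in> vec.span {v}" "u \<noteq> 0"
  shows "vec.span {u} = vec.span {v}"
proof -
  obtain k where k: "u = k *s v" using assms by (auto simp: in_span_singleton)
  with assms have "v = inverse k *s u" by (auto simp: vector_smult_assoc)
  then have "v \<in> vec.span {u}" by (metis in_span_singleton)
  with assms show ?thesis
    by (simp add: vec.span_eq)
qed

section \<open>Sums over flats and double counting\<close>

text \<open>A flat is encoded by a base point and its direction space, so that parallel flats share
  the argument \<open>S\<close>. Below, the value is called the weight of the flat.\<close>

definition flat_sum :: "('a::{field,finite} ^ 'n::finite \<Rightarrow> real) \<Rightarrow> 'a ^ 'n \<Rightarrow> ('a ^ 'n) set \<Rightarrow> real"
  where "flat_sum f p S = (\<Sum>v\<in>S. f (p + v))"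

lemma sum_translate_subspace:
  fixes S :: "('a::{field,finite} ^ 'n::finite) set"
  assumes "vec.subspace S" "w \<in> S"
  shows "(\<Sum>v\<in>S. g (w + v)) = sum g S"
  by (rule sum.reindex_bij_witness[where i = "\<lambda>v. v - w" and j = "\<lambda>v. w + v"])
     (use assms in \<open>auto intro: vec.subspace_add vec.subspace_diff\<close>)

lemma flat_sum_cong_base:
  fixes S :: "('a::{field,finite} ^ 'n::finite) set"
  assumes "vec.subspace S" "p' - p \<in> S"
  shows "flat_sum f p' S = flat_sum f p S"
  unfolding flat_sum_def
  using sum_translate_subspace[OF assms, of "\<lambda>v. f (p + v)"] by simp

text \<open>Summing over vectors \<open>v\<close> instead of over cosets of \<open>T\<close> avoids
  choosing representatives; the price is the factor \<open>card T\<close>, since each coset is met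
  that many times.\<close>

lemma sum_flat_sum:
  fixes S :: "('a::{field,finite} ^ 'n::finite) set"
  assumes "vec.subspace S" "T \<subseteq> S"
  shows "(\<Sum>v\<in>S. flat_sum f (p + v) T) = card T * flat_sum f p S"
proof -
  have "(\<Sum>v\<in>S. flat_sum f (p + v) T) = (\<Sum>w\<in>T. \<Sum>v\<in>S. f (p + (w + v)))"
    unfolding flat_sum_def by (subst sum.swap) (simp add: add_ac)
  also have "\<dots> = (\<Sum>w\<in>T. flat_sum f p S)"
    unfolding flat_sum_def
    using assms by (intro sum.cong refl sum_translate_subspace[where g = "\<lambda>v. f (p + v)"]) auto
  finally show ?thesis by simp
qed

text \<open>The averaging identity for the flats of one dimension more through \<open>p + S\<close>
  inside \<open>p + R\<close>, each indexed by all vectors \<open>v\<close> that generate it over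
  \<open>S\<close>. The part \<open>p + S\<close> is counted for every \<open>v\<close>, and any
  other point for \<open>(q - 1) * card S\<close> of them. It is applied with a point, a line and a
  plane as \<open>p + S\<close>.\<close>

lemma sum_flat_sum_span_insert:
  fixes S R :: "('a::{field,finite} ^ 'n::finite) set"
  assumes S: "vec.subspace S" and R: "vec.subspace R" and "S \<subseteq> R"
  shows "(\<Sum>v\<in>R - S. flat_sum f p (vec.span (insert v S))) =
    (real (card R) - card S) * flat_sum f p S
    + (real CARD('a) - 1) * card S * (flat_sum f p R - flat_sum f p S)"
proof -
  define U where "U v = vec.span (insert v S) - S" for v
  have SU: "S \<subseteq> vec.span (insert v S)" for v
    by (meson subset_insertI vec.span_superset order_trans)
  have UR: "U v \<subseteq> R - S" if "v \<in> R" for v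
    using that assms unfolding U_def by (metis Diff_mono insert_subset order_refl vec.span_minimal)
  \<comment> \<open>The exchange property makes membership in \<open>U\<close> symmetric, so
    swapping the double sum reduces it to counting \<open>U w\<close>.\<close>
  have sym: "w \<in> U v \<longleftrightarrow> v \<in> U w" if "v \<in> R - S" "w \<in> R - S" for v w
  proof -
    have "v \<notin> vec.span S" "w \<notin> vec.span S"
      using that S by (metis DiffD2 vec.span_eq_iff)+
    then show ?thesis
      using that vec.in_span_insert[of v w S] vec.in_span_insert[of w v S] by (auto simp: U_def)
  qed
  have cardU: "real (card (U w)) = (real CARD('a) - 1) * card S" if "w \<in> R - S" for w
    using that card_span_insert[OF S, of w] SU[of w]
    by (simp add: U_def card_Diff_subset of_nat_diff card_mono algebra_simps)
  have split: "flat_sum f p (vec.span (insert v S)) = flat_sum f p S + (\<Sum>w\<in>U v. f (p + w))" for v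
    unfolding flat_sum_def U_def by (subst sum.subset_diff[OF SU[of v]]) auto
  have "(\<Sum>v\<in>R - S. \<Sum>w\<in>U v. f (p + w)) =
        (\<Sum>v\<in>R - S. \<Sum>w\<in>R - S. if w \<in> U v then f (p + w) else 0)"
  proof (rule sum.cong[OF refl])
    fix v assume "v \<in> R - S"
    then have "(R - S) \<inter> U v = U v" using UR[of v] by auto
    then show "(\<Sum>w\<in>U v. f (p + w)) = (\<Sum>w\<in>R - S. if w \<in> U v then f (p + w) else 0)"
      by (simp add: sum.If_cases flip: Int_def)
  qed
  also have "\<dots> = (\<Sum>w\<in>R - S. \<Sum>v\<in>R - S. if v \<in> U w then f (p + w) else 0)"
    by (subst sum.swap) (intro sum.cong refl, simp add: sym)
  also have "\<dots> = (\<Sum>w\<in>R - S. (real CARD('a) - 1) * card S * f (p + w))"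
  proof (rule sum.cong[OF refl])
    fix w assume w: "w \<in> R - S"
    then have "(R - S) \<inter> U w = U w" using UR[of w] by auto
    then show "(\<Sum>v\<in>R - S. if v \<in> U w then f (p + w) else 0)
        = (real CARD('a) - 1) * card S * f (p + w)"
      using cardU[OF w] by (simp add: sum.If_cases flip: Int_def)
  qed
  also have "\<dots> = (real CARD('a) - 1) * card S * (flat_sum f p R - flat_sum f p S)"
    unfolding flat_sum_def using \<open>S \<subseteq> R\<close>
    by (simp add: sum_diff flip: sum_distrib_left)
  finally show ?thesis
    using \<open>S \<subseteq> R\<close>
    by (simp add: split sum.distrib card_Diff_subset of_nat_diff card_mono)
qed

section \<open>Cosets and intersections of subspaces\<close>

text \<open>\<open>A\<close> is a disjoint union of cosets of \<open>T\<close>. This is the source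
  of the integrality of weights.\<close>

lemma card_subspace_dvd_card:
  fixes T :: "('a::{field,finite} ^ 'n::finite) set"
  assumes T: "vec.subspace T" and A: "\<And>a t. a \<in> A \<Longrightarrow> t \<in> T \<Longrightarrow> a + t \<in> A"
  shows "card T dvd card A"
proof -
  let ?C = "(\<lambda>a. (+) a ` T) ` A"
  have "card (\<Union>?C) = card T * card ?C"
  proof (rule card_partition[symmetric])
    show "finite ?C" "finite (\<Union>?C)" by auto
    show "card c = card T" if "c \<in> ?C" for c
      using that by (auto simp: card_image)
    show "c1 \<inter> c2 = {}" if "c1 \<in> ?C" "c2 \<in> ?C" "c1 \<noteq> c2" for c1 c2
    proof (rule ccontr)
      assume "c1 \<inter> c2 \<noteq> {}"
      then obtain a b s t where ab: "c1 = (+) a ` T" "c2 = (+) b ` T" and st: "s \<in> T" "t \<in> T" "a + s = b + t"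
        using \<open>c1 \<in> ?C\<close> \<open>c2 \<in> ?C\<close> by blast
      have "a - b = t - s" using st(3) by (simp add: algebra_simps)
      then have D: "a - b \<in> T" using T st by (simp add: vec.subspace_diff)
      have "c1 = c2"
      proof (intro set_eqI iffI)
        fix x assume "x \<in> c1"
        then obtain u where u: "u \<in> T" "x = a + u" using ab by auto
        then have "x = b + ((a - b) + u)" by simp
        with u D show "x \<in> c2" using vec.subspace_add[OF T D] ab by blast
      next
        fix x assume "x \<in> c2"
        then obtain u where u: "u \<in> T" "x = b + u" using ab by auto
        then have "x = a + (u - (a - b))" by simp
        with u D show "x \<in> c1" using vec.subspace_diff[OF T] ab by blast
      qed
      with that show False by simp
    qed
  qed
  moreover have "\<Union>?C = A"
    using A vec.subspace_0[OF T] by (force simp: image_iff)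
  ultimately show ?thesis by simp
qed

text \<open>Pigeonhole in place of the dimension formula: the difference map from
  \<open>D \<times> D'\<close> to \<open>S\<close> cannot be injective, and a collision yields a
  common nonzero vector.\<close>

lemma subspace_Int_nontrivial:
  fixes D D' S :: "('a::{field,finite} ^ 'n::finite) set"
  assumes D: "vec.subspace D" and D': "vec.subspace D'" and S: "vec.subspace S"
    and sub: "D \<subseteq> S" "D' \<subseteq> S" and card: "card S < card D * card D'"
  obtains e where "e \<in> D" "e \<in> D'" "e \<noteq> 0"
proof -
  have "\<not> inj_on (\<lambda>(u, v). u - v) (D \<times> D')"
  proof
    assume "inj_on (\<lambda>(u, v). u - v) (D \<times> D')"
    moreover have "(\<lambda>(u, v). u - v) ` (D \<times> D') \<subseteq> S"
      using sub S by (auto intro: vec.subspace_diff)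
    ultimately have "card (D \<times> D') \<le> card S"
      by (intro card_inj_on_le) auto
    with card show False by (simp add: card_cartesian_product)
  qed
  then obtain u v u' v' where *: "u \<in> D" "u' \<in> D" "v \<in> D'" "v' \<in> D'"
      "u - v = u' - v'" "(u, v) \<noteq> (u', v')"
    by (auto simp: inj_on_def)
  have eq: "u - u' = v - v'" using *(5) by (simp add: algebra_simps)
  show ?thesis
  proof
    show "u - u' \<in> D" using * D by (simp add: vec.subspace_diff)
    show "u - u' \<in> D'" unfolding eq using * D' by (simp add: vec.subspace_diff)
    show "u - u' \<noteq> 0" using * by auto
  qed
qed

section \<open>Point functions whose line sums are 0 or 1\<close>

text \<open>Only the line sums are restricted; \<open>f\<close> itself may take arbitrary real
  values. The lines with sum 1 play the role of the line class.\<close>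

locale line_indicator =
  fixes f :: "'a::{field,finite} ^ 'n::finite \<Rightarrow> real"
  assumes line_values: "d \<noteq> 0 \<Longrightarrow> flat_sum f p (vec.span {d}) \<in> {0, 1}"
begin

abbreviation F where "F \<equiv> flat_sum f"

text \<open>Up to a positive factor, the weight is a sum of line weights in the direction
  \<open>d\<close>. The nonzero \<open>d\<close> rules out single points, on which no sign is
  imposed.\<close>

lemma flat_sum_nonneg:
  assumes S: "vec.subspace S" and d: "d \<in> S" "d \<noteq> 0"
  shows "F p S \<ge> 0"
proof -
  have "vec.span {d} \<subseteq> S" using S d by (simp add: vec.span_minimal)
  then have "card (vec.span {d}) * F p S = (\<Sum>v\<in>S. F (p + v) (vec.span {d}))"
    using sum_flat_sum[OF S] by simp
  also have "\<dots> \<ge> 0"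
    using line_values[OF d(2)] by (intro sum_nonneg) (metis empty_iff insert_iff order_refl zero_le_one)
  finally show ?thesis
    using d by (simp add: card_span_singleton zero_le_mult_iff)
qed

text \<open>Each line of direction \<open>d\<close> is counted once for each of its points, hence
  the factor \<open>CARD('a)\<close>.\<close>

lemma card_flat_sum_lines:
  assumes S: "vec.subspace S" and d: "d \<in> S" "d \<noteq> 0"
  shows "real (card {v \<in> S. F (p + v) (vec.span {d}) = 1}) = CARD('a) * F p S"
proof -
  have "vec.span {d} \<subseteq> S" using S d by (simp add: vec.span_minimal)
  then have "CARD('a) * F p S = (\<Sum>v\<in>S. F (p + v) (vec.span {d}))"
    using sum_flat_sum[OF S] d by (simp add: card_span_singleton)
  also have "\<dots> = (\<Sum>v\<in>S. if F (p + v) (vec.span {d}) = 1 then 1 else 0)"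
    using line_values[OF d(2)] by (intro sum.cong refl) (metis empty_iff insert_iff)
  also have "\<dots> = card {v \<in> S. F (p + v) (vec.span {d}) = 1}"
    by (simp add: sum.If_cases Int_def)
  finally show ?thesis by simp
qed

text \<open>The set of points on lines of weight 1 in direction \<open>d\<close> is invariant under
  translation along \<open>d\<close>, so the count \<open>CARD('a) * F p S\<close> is divisible by
  \<open>CARD('a)\<close>.\<close>

lemma flat_sum_Nats:
  assumes S: "vec.subspace S" and d: "d \<in> S" "d \<noteq> 0"
  shows "F p S \<in> \<nat>"
proof -
  let ?A = "{v \<in> S. F (p + v) (vec.span {d}) = 1}"
  have T: "vec.span {d} \<subseteq> S" using S d by (simp add: vec.span_minimal)
  have "card (vec.span {d}) dvd card ?A"
  proof (rule card_subspace_dvd_card)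
    fix a t assume a: "a \<in> ?A" and t: "t \<in> vec.span {d}"
    have "F (p + (a + t)) (vec.span {d}) = F (p + a) (vec.span {d})"
      using t by (intro flat_sum_cong_base) auto
    with a t T S show "a + t \<in> ?A" by (auto intro: vec.subspace_add)
  qed simp
  then obtain k where "card ?A = CARD('a) * k"
    using d by (auto simp: card_span_singleton)
  then have "real CARD('a) * k = CARD('a) * F p S"
    using card_flat_sum_lines[OF S d, of p] by simp
  then have "F p S = real k" by simp
  then show ?thesis by simp
qed

text \<open>The translates of \<open>T\<close> partition \<open>p + S\<close>, and all of them have
  nonnegative weight; \<open>a + T\<close> and \<open>b + T\<close> are two different ones among
  them.\<close>

lemma flat_sum_disjoint:
  assumes S: "vec.subspace S" and T: "vec.subspace T" and "T \<subseteq> S"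
    and d: "d \<in> T" "d \<noteq> 0" and ab: "a - p \<in> S" "b - p \<in> S" "a - b \<notin> T"
  shows "F a T + F b T \<le> F p S"
proof -
  let ?A = "(+) (a - p) ` T" and ?B = "(+) (b - p) ` T"
  have const: "(\<Sum>v\<in>(+) (c - p) ` T. F (p + v) T) = card T * F c T" for c
  proof -
    have "(\<Sum>v\<in>(+) (c - p) ` T. F (p + v) T) = (\<Sum>w\<in>T. F (c + w) T)"
      by (subst sum.reindex) (auto simp: inj_on_def)
    then show ?thesis using sum_flat_sum[OF T order_refl] by simp
  qed
  have disj: "?A \<inter> ?B = {}"
  proof (rule ccontr)
    assume "?A \<inter> ?B \<noteq> {}"
    then obtain s t where st: "s \<in> T" "t \<in> T" "a - p + s = b - p + t" by auto
    then have "a - b = t - s" by (simp add: algebra_simps)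
    then show False using st ab T by (simp add: vec.subspace_diff)
  qed
  have "card T * (F a T + F b T) = (\<Sum>v\<in>?A \<union> ?B. F (p + v) T)"
    using disj by (subst sum.union_disjoint) (simp_all add: const distrib_left)
  also have "\<dots> \<le> (\<Sum>v\<in>S. F (p + v) T)"
  proof (rule sum_mono2)
    show "?A \<union> ?B \<subseteq> S"
      using ab S \<open>T \<subseteq> S\<close> by (auto intro: vec.subspace_add)
  qed (use flat_sum_nonneg[OF T d] in auto)
  also have "\<dots> = card T * F p S"
    using sum_flat_sum[OF S \<open>T \<subseteq> S\<close>] .
  finally have "card T * (F a T + F b T) \<le> card T * F p S" .
  moreover have "card T > 0" using d by (auto simp: card_gt_0_iff)
  ultimately show ?thesis by simp
qed

text \<open>If \<open>T\<close> is proper, a second translate of \<open>T\<close> exists inside the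
  larger flat, and superadditivity applies with its nonnegative weight dropped.\<close>

lemma flat_sum_mono:
  assumes S: "vec.subspace S" and T: "vec.subspace T" and "T \<subseteq> S"
    and d: "d \<in> T" "d \<noteq> 0" and a: "a - p \<in> S"
  shows "F a T \<le> F p S"
proof (cases "T = S")
  case True
  then show ?thesis using flat_sum_cong_base[OF S a] by simp
next
  case False
  then obtain s where s: "s \<in> S" "s \<notin> T" using \<open>T \<subseteq> S\<close> by auto
  have "F a T + F (a - s) T \<le> F p S"
  proof (rule flat_sum_disjoint[OF S T \<open>T \<subseteq> S\<close> d a])
    show "a - s - p \<in> S"
      using vec.subspace_diff[OF S a s(1)] by (simp add: algebra_simps)
  qed (use s in auto)
  then show ?thesis using flat_sum_nonneg[OF T d, of "a - s"] by linarith
qed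

lemma line_exists:
  assumes S: "vec.subspace S" and d: "d \<in> S" "d \<noteq> 0" and "F p S \<ge> 1"
  obtains a where "a - p \<in> S" "F a (vec.span {d}) = 1"
proof -
  have "real (card {v \<in> S. F (p + v) (vec.span {d}) = 1}) \<noteq> 0"
    unfolding card_flat_sum_lines[OF S d] using assms by simp
  then have "card {v \<in> S. F (p + v) (vec.span {d}) = 1} \<noteq> 0" by linarith
  then obtain v where "v \<in> S" "F (p + v) (vec.span {d}) = 1"
    by (metis (mono_tags, lifting) card.empty empty_Collect_eq)
  then show ?thesis using that[of "p + v"] by simp
qed

text \<open>A single line accounts for only \<open>CARD('a)\<close> of the vectors \<open>v\<close>,
  whereas weight at least 2 requires twice as many.\<close>

lemma two_lines_exist:
  assumes S: "vec.subspace S" and d: "d \<in> S" "d \<noteq> 0" and "F p S \<ge> 2"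
  obtains a b where "a - p \<in> S" "b - p \<in> S" "F a (vec.span {d}) = 1" "F b (vec.span {d}) = 1"
    "b - a \<notin> vec.span {d}"
proof -
  obtain a where a: "a - p \<in> S" "F a (vec.span {d}) = 1"
    using line_exists[OF S d, of p] assms by auto
  let ?A = "{v \<in> S. F (p + v) (vec.span {d}) = 1}"
  have "\<not> ?A \<subseteq> (+) (a - p) ` vec.span {d}"
  proof
    assume "?A \<subseteq> (+) (a - p) ` vec.span {d}"
    then have "card ?A \<le> card ((+) (a - p) ` vec.span {d})" by (intro card_mono) auto
    then have "card ?A \<le> CARD('a)" using d by (simp add: card_image card_span_singleton)
    then have "real CARD('a) * F p S \<le> real CARD('a) * 1"
      unfolding card_flat_sum_lines[OF S d, of p, symmetric] by simp
    then have "F p S \<le> 1" by (simp only: mult_le_cancel_left_pos of_nat_0_less_iff zero_less_card_finite)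
    then show False using assms by simp
  qed
  then obtain v where v: "v \<in> ?A" "v \<notin> (+) (a - p) ` vec.span {d}" by auto
  have "p + v - a \<notin> vec.span {d}"
  proof
    assume "p + v - a \<in> vec.span {d}"
    then have "(a - p) + (p + v - a) \<in> (+) (a - p) ` vec.span {d}" by (rule imageI)
    with v show False by simp
  qed
  with a v show ?thesis by (intro that[of a "p + v"]) auto
qed

section \<open>Solids of weight two\<close>

text \<open>
  In a solid of weight two, the two parallel lines of each direction span a plane of weight two,
  and any two such planes share a direction and hence coincide.
\<close>

lemma plane_direction_unique:
  assumes S: "vec.subspace S" "card S = CARD('a) ^ 3" "F p S = 2"
    and D: "vec.subspace D" "D \<subseteq> S" "card D = CARD('a) ^ 2" "a - p \<in> S" "F a D = 2"
    and D': "vec.subspace D'" "D' \<subseteq> S" "card D' = CARD('a) ^ 2" "a' - p \<in> S" "F a' D' = 2"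
  shows "D = D'"
proof -
  have q: "CARD('a) > 1" by (rule card_field_gt_1)
  have "card S < card D * card D'"
    unfolding S D D' using q by (simp flip: power_add)
  then obtain e where e: "e \<in> D" "e \<in> D'" "e \<noteq> 0"
    using subspace_Int_nontrivial[OF D(1) D'(1) S(1) D(2) D'(2)] by blast
  obtain b c where bc: "b - a \<in> D" "c - a \<in> D" "F b (vec.span {e}) = 1" "F c (vec.span {e}) = 1"
    "c - b \<notin> vec.span {e}"
    using two_lines_exist[OF D(1) e(1,3), of a] D by auto
  \<comment> \<open>All of the weight 2 already lies in \<open>a' + D'\<close>. A line of weight 1
    in direction \<open>e\<close> outside it would lie in a parallel plane and raise the total to at
    least 3.\<close>
  have in_D': "x - a' \<in> D'" if x: "x - a \<in> D" "F x (vec.span {e}) = 1" for x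
  proof (rule ccontr)
    assume "x - a' \<notin> D'"
    moreover have "x - p \<in> S"
      using vec.subspace_add[OF S(1), of "x - a" "a - p"] x D by auto
    ultimately have "F x D' + F a' D' \<le> F p S"
      using D' by (intro flat_sum_disjoint[OF S(1) D'(1,2) e(2,3)])
    moreover have "F x (vec.span {e}) \<le> F x D'"
      using e D' by (intro flat_sum_mono[where d = e])
        (auto simp: vec.span_minimal vec.span_base vec.subspace_0)
    ultimately show False using x D' S by simp
  qed
  have "(c - a') - (b - a') \<in> D'" by (rule vec.subspace_diff[OF D'(1) in_D'[OF bc(2,4)] in_D'[OF bc(1,3)]])
  moreover have "(c - a) - (b - a) \<in> D" by (rule vec.subspace_diff[OF D(1) bc(2,1)])
  ultimately have cb: "c - b \<in> D'" "c - b \<in> D" by simp_all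
  \<comment> \<open>Both lines lie in both planes, so \<open>c - b\<close> and \<open>e\<close> span
    a plane contained in \<open>D\<close> and in \<open>D'\<close>.\<close>
  have card: "card (vec.span {c - b, e}) = CARD('a) ^ 2"
    using bc e by (intro card_span_pair) auto
  have "vec.span {c - b, e} = D"
    using cb e D card by (intro card_subset_eq vec.span_minimal) auto
  moreover have "vec.span {c - b, e} = D'"
    using cb e D' card by (intro card_subset_eq vec.span_minimal) auto
  ultimately show ?thesis by simp
qed

text \<open>Two parallel lines of weight 1 span a plane, whose weight is at least 1 + 1 by
  superadditivity and at most 2 by monotonicity.\<close>

lemma plane_direction_exists:
  assumes S: "vec.subspace S" "F p S = 2" and d: "d \<in> S" "d \<noteq> 0"
  obtains D a where "vec.subspace D" "D \<subseteq> S" "card D = CARD('a) ^ 2" "a - p \<in> S" "F a D = 2" "d \<in> D"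
proof -
  obtain a b where ab: "a - p \<in> S" "b - p \<in> S" "F a (vec.span {d}) = 1" "F b (vec.span {d}) = 1"
    "b - a \<notin> vec.span {d}"
    using two_lines_exist[OF S(1) d, of p] S by auto
  define D where "D = vec.span {b - a, d}"
  have baS: "b - a \<in> S" using vec.subspace_diff[OF S(1) ab(2,1)] by simp
  have D: "vec.subspace D" "D \<subseteq> S" "d \<in> D" "b - a \<in> D" "card D = CARD('a) ^ 2"
    unfolding D_def using vec.span_minimal[of "{b - a, d}" S] baS S d ab
    by (simp_all add: vec.span_base card_span_pair)
  have "F b (vec.span {d}) + F a (vec.span {d}) \<le> F a D"
    using D d ab by (intro flat_sum_disjoint[where d = d])
      (auto simp: vec.span_minimal vec.span_base vec.subspace_0)
  moreover have "F a D \<le> F p S"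
    using D d ab S by (intro flat_sum_mono[where d = d]) auto
  ultimately have "F a D = 2" using ab S by simp
  with D ab show ?thesis using that by blast
qed

text \<open>Each direction of the solid lies in some plane of weight 2, and these planes all have
  the same direction space \<open>D\<close>. Hence \<open>D\<close> would be all of
  \<open>S\<close>, which is too large.\<close>

lemma solid_sum_ne_2:
  assumes S: "vec.subspace S" "card S = CARD('a) ^ 3"
  shows "F p S \<noteq> 2"
proof
  assume F: "F p S = 2"
  have q: "CARD('a) > 1" by (rule card_field_gt_1)
  then have "card S > 1" using S one_less_power[OF q, of 3] by simp
  then obtain d where d: "d \<in> S" "d \<noteq> 0"
    by (metis (no_types) card_le_Suc0_iff_eq finite not_less One_nat_def)
  obtain D a where D: "vec.subspace D" "D \<subseteq> S" "card D = CARD('a) ^ 2" "a - p \<in> S" "F a D = 2" "d \<in> D"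
    using plane_direction_exists[OF S(1) F d] by metis
  have "e \<in> D" if "e \<in> S" for e
  proof (cases "e = 0")
    case True
    then show ?thesis using D vec.subspace_0 by auto
  next
    case False
    obtain D' a' where D': "vec.subspace D'" "D' \<subseteq> S" "card D' = CARD('a) ^ 2" "a' - p \<in> S"
        "F a' D' = 2" "e \<in> D'"
      using plane_direction_exists[OF S(1) F \<open>e \<in> S\<close> False] by metis
    then show ?thesis using plane_direction_unique[OF S F D(1-5) D'(1-5)] by simp
  qed
  then have "D = S" using D by auto
  then show False using D(3) S(2) q by simp
qed

section \<open>Solids of weight one\<close>

text \<open>Otherwise the two lines lie in disjoint translates of \<open>vec.span {d, e}\<close>,
  and the solid has weight at least 2. For independent directions the conclusion says that the lines
  intersect.\<close>

lemma lines_meet: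
  assumes S: "vec.subspace S" "F p S = 1" and de: "d \<in> S" "e \<in> S" "d \<noteq> 0" "e \<noteq> 0"
    and ab: "a - p \<in> S" "b - p \<in> S" "F a (vec.span {d}) = 1" "F b (vec.span {e}) = 1"
  shows "a - b \<in> vec.span {d, e}"
proof (rule ccontr)
  let ?D = "vec.span {d, e}"
  assume "a - b \<notin> ?D"
  then have "F a ?D + F b ?D \<le> F p S"
    using S de ab vec.span_minimal[of "{d, e}" S]
    by (intro flat_sum_disjoint[where d = d]) (simp_all add: vec.span_base)
  moreover have "F a (vec.span {d}) \<le> F a ?D"
    using de by (intro flat_sum_mono[where d = d]) (auto simp: vec.span_base vec.span_zero intro!: vec.span_mono)
  moreover have "F b (vec.span {e}) \<le> F b ?D"
    using de by (intro flat_sum_mono[where d = e]) (auto simp: vec.span_base vec.span_zero intro!: vec.span_mono)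
  ultimately show False using ab S by simp
qed

text \<open>The line of weight 1 in direction \<open>g\<close> meets both given lines through
  \<open>P\<close>. Since it is not parallel to their plane, it hits that plane only once, so both
  meeting points are \<open>P\<close>.\<close>

lemma line_through_meeting_point:
  assumes S: "vec.subspace S" "F p S = 1" and P: "P - p \<in> S"
    and d: "d \<in> S" "d \<noteq> 0" "F P (vec.span {d}) = 1"
    and e: "e \<in> S" "e \<notin> vec.span {d}" "F P (vec.span {e}) = 1"
    and g: "g \<in> S" "g \<notin> vec.span {d, e}"
  shows "F P (vec.span {g}) = 1"
proof -
  have nz: "e \<noteq> 0" "g \<noteq> 0" using e g by (auto simp: vec.span_zero)
  obtain c where c: "c - p \<in> S" "F c (vec.span {g}) = 1"
    using line_exists[OF S(1) g(1) nz(2), of p] S by auto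
  obtain s t where st: "P - c = s *s d + t *s g"
    using lines_meet[OF S d(1) g(1) d(2) nz(2) P c(1) d(3) c(2)] by (auto simp: in_span_pair)
  obtain s' t' where st': "P - c = s' *s e + t' *s g"
    using lines_meet[OF S e(1) g(1) nz P c(1) e(3) c(2)] by (auto simp: in_span_pair)
  have eq: "(t - t') *s g = (- s) *s d + s' *s e"
    using st st' by (simp add: vec.scale_left_diff_distrib algebra_simps)
  have "t = t'"
  proof (rule ccontr)
    assume "t \<noteq> t'"
    then have "g = inverse (t - t') *s ((t - t') *s g)" by (simp only: vector_smult_assoc) simp
    also have "\<dots> \<in> vec.span {d, e}"
      unfolding eq by (intro vec.span_scale vec.span_add vec.span_base) auto
    finally show False using g by simp
  qed
  have "s' = 0"
  proof (rule ccontr)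
    assume "s' \<noteq> 0"
    then have "e = inverse s' *s (s' *s e)" by (simp add: vector_smult_assoc)
    also have "s' *s e = s *s d" using eq \<open>t = t'\<close> by (simp add: vec.scale_minus_left)
    also have "inverse s' *s (s *s d) \<in> vec.span {d}"
      by (intro vec.span_scale vec.span_base) auto
    finally show False using e by simp
  qed
  then have "P - c \<in> vec.span {g}" using st' by (auto simp: in_span_singleton)
  then show ?thesis using flat_sum_cong_base[of "vec.span {g}" P c] c by simp
qed

text \<open>Two lines of weight 1 in independent directions meet in a point \<open>P\<close>. Every
  line of the solid through \<open>P\<close> then has weight 1, and summing over these lines
  determines \<open>f P\<close>.\<close>

lemma exists_full_point:
  assumes S: "vec.subspace S" "card S = CARD('a) ^ 3" and F: "F p S = 1"
  obtains P where "f P = 1"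
proof -
  have q: "CARD('a) > 1" by (rule card_field_gt_1)
  have ex: "\<exists>v\<in>S. v \<notin> T" if "card T < CARD('a) ^ 3" for T
    using card_mono[of T S] that S by (auto simp: subset_iff not_le[symmetric])
  obtain d where d: "d \<in> S" "d \<noteq> 0"
    using ex[of "{0}"] one_less_power[OF q, of 3] by auto
  obtain e where e: "e \<in> S" "e \<notin> vec.span {d}"
    using ex[of "vec.span {d}"] d power_strict_increasing[OF _ q, of 1 3] by (auto simp: card_span_singleton)
  obtain h where h: "h \<in> S" "h \<notin> vec.span {d, e}"
    using ex[of "vec.span {e, d}"] d e power_strict_increasing[OF _ q, of 2 3]
    card_span_pair[OF d(2) e(2)] by (auto simp: insert_commute[of e d])
  have nz: "e \<noteq> 0" using e by (auto simp: vec.span_zero)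
  obtain a b where ab: "a - p \<in> S" "b - p \<in> S" "F a (vec.span {d}) = 1" "F b (vec.span {e}) = 1"
    using line_exists[OF S(1) d, of p] line_exists[OF S(1) e(1) nz, of p] F by (metis order_refl)
  obtain s t where st: "a - b = s *s d + t *s e"
    using lines_meet[OF S(1) F d(1) e(1) d(2) nz ab] by (auto simp: in_span_pair)
  \<comment> \<open>The meeting point: it lies on the line through \<open>a\<close> by definition
    and on the line through \<open>b\<close> by \<open>P2\<close>.\<close>
  define P where "P = a - s *s d"
  have P2: "P = b + t *s e" using st by (simp add: P_def algebra_simps)
  have "(a - p) - s *s d \<in> S"
    using vec.subspace_diff[OF S(1) ab(1)] vec.subspace_scale[OF S(1) d(1)] by blast
  then have P: "P - p \<in> S" by (simp add: P_def algebra_simps)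
  have "F P (vec.span {d}) = F a (vec.span {d})"
    by (rule flat_sum_cong_base) (simp_all add: P_def vec.span_neg vec.span_scale vec.span_base)
  then have Pd: "F P (vec.span {d}) = 1" using ab by simp
  have "F P (vec.span {e}) = F b (vec.span {e})"
    by (rule flat_sum_cong_base) (simp_all add: P2 vec.span_scale vec.span_base)
  then have Pe: "F P (vec.span {e}) = 1" using ab by simp
  note through = line_through_meeting_point[OF S(1) F P d Pd]
  have Ph: "F P (vec.span {h}) = 1" using through[OF e Pe h] .
  have hd: "h \<notin> vec.span {d}"
    using h vec.span_mono[of "{d}" "{d, e}"] by auto
  have all: "F P (vec.span {g}) = 1" if g: "g \<in> S" "g \<noteq> 0" for g
  proof (cases "g \<in> vec.span {d}")
    case True
    then show ?thesis using span_singleton_eq[OF True g(2)] Pd by simp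
  next
    case gd: False
    \<comment> \<open>The planes spanned by \<open>d, e\<close> and by \<open>d, h\<close> share
      only the direction \<open>d\<close>, so one of the two pairs of lines through \<open>P\<close>
      handles \<open>g\<close>.\<close>
    have "g \<notin> vec.span {d, e} \<or> g \<notin> vec.span {d, h}"
    proof (rule ccontr, clarsimp)
      assume de: "g \<in> vec.span {d, e}" and "g \<in> vec.span {d, h}"
      then obtain s t where st: "g = s *s d + t *s h" by (auto simp: in_span_pair)
      have "t \<noteq> 0" using st gd by (auto simp: in_span_singleton)
      then have "h = inverse t *s (g - s *s d)"
        using st by (simp add: vector_smult_assoc)
      also have "\<dots> \<in> vec.span {d, e}"
        by (intro vec.span_scale vec.span_diff de vec.span_base) auto
      finally show False using h by simp
    qed
    then show ?thesis using through[OF e Pe g(1)] through[OF h(1) hd Ph g(1)] by blast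
  qed
  \<comment> \<open>The averaging identity with the zero subspace, that is, over the lines of the
    solid through \<open>P\<close>.\<close>
  have "(\<Sum>v\<in>S - {0}. F P (vec.span (insert v {0}))) = (\<Sum>v\<in>S - {0}. 1)"
    using all by (intro sum.cong refl) (simp add: insert_commute[of _ 0] vec.span_insert_0)
  moreover have "0 \<in> S" using S vec.subspace_0 by auto
  moreover have "F P S = 1" using flat_sum_cong_base[OF S(1) P] F by simp
  moreover have "F P {0} = f P" by (simp add: flat_sum_def)
  ultimately have "real CARD('a) ^ 3 - 1 = (real CARD('a) ^ 3 - 1) * f P + (real CARD('a) - 1) * (1 - f P)"
    using sum_flat_sum_span_insert[of "{0}" S f P] S by (simp add: of_nat_diff card_gt_0_iff Suc_leI)
  then have "(real CARD('a) ^ 3 - real CARD('a)) * (1 - f P) = 0" by (simp add: algebra_simps)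
  moreover have "real CARD('a) ^ 3 > real CARD('a) ^ 1"
    using q by (intro power_strict_increasing) auto
  ultimately have "f P = 1" by simp
  then show ?thesis by (rule that)
qed

text \<open>On each line through \<open>P\<close> the points other than \<open>P\<close> sum to at
  most 0, and these punctured lines cover the rest of the space once.\<close>

lemma total_sum_le_1:
  assumes "f P = 1"
  shows "F p UNIV \<le> 1"
proof -
  have q: "CARD('a) > 1" by (rule card_field_gt_1)
  have "(\<Sum>v\<in>UNIV - {0}. F P (vec.span (insert v {0}))) \<le> (\<Sum>v\<in>UNIV - {0 :: 'a ^ 'n}. 1)"
  proof (rule sum_mono)
    fix v :: "'a ^ 'n" assume "v \<in> UNIV - {0}"
    then show "F P (vec.span (insert v {0})) \<le> 1"
      using line_values[of v P] by (auto simp: insert_commute[of _ 0] vec.span_insert_0)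
  qed
  moreover have "F P {0} = 1" using assms by (simp add: flat_sum_def)
  moreover have "(\<Sum>v\<in>UNIV - {0 :: 'a ^ 'n}. 1) = real CARD('a ^ 'n) - 1"
    by (simp add: card_Diff_subset of_nat_diff Suc_leI)
  moreover have "F P UNIV = F p UNIV" by (rule flat_sum_cong_base) auto
  ultimately have "(real CARD('a) - 1) * (F p UNIV - 1) \<le> 0"
    using sum_flat_sum_span_insert[of "{0}" UNIV f P] by (simp add: vec.subspace_0)
  with q show ?thesis by (simp add: mult_le_0_iff)
qed

section \<open>Averaging over solids and planes\<close>

text \<open>The weight is an integer and at least 1 because of the line. The value 1 would force
  total weight at most 1, and the value 2 is impossible.\<close>

lemma solid_sum_ge_3:
  assumes S: "vec.subspace S" "card S = CARD('a) ^ 3" and x: "F p UNIV > 1"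
    and d: "d \<in> S" "d \<noteq> 0" "F p (vec.span {d}) = 1"
  shows "F p S \<ge> 3"
proof -
  have "F p (vec.span {d}) \<le> F p S"
    using S d by (intro flat_sum_mono[where d = d])
      (simp_all add: vec.span_base vec.subspace_0 vec.span_minimal)
  moreover have "F p S \<noteq> 1"
    using exists_full_point[OF S] total_sum_le_1[of _ p] x by (metis not_le)
  moreover obtain k where "F p S = real k"
    using flat_sum_Nats[OF S(1) d(1,2)] by (auto elim: Nats_cases)
  ultimately show ?thesis
    using solid_sum_ne_2[OF S, of p] d(3) by (cases "k = 0 \<or> k = 1 \<or> k = 2") auto
qed

text \<open>Every solid through the plane has weight at least 3; this bound is summed over all
  \<open>v\<close> outside the plane direction and expanded by the averaging identity.\<close>

lemma sum_plane_solids: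
  assumes S: "vec.subspace S" "card S = CARD('a) ^ 2" and x: "F p UNIV > 1"
    and d: "d \<in> S" "d \<noteq> 0" "F p (vec.span {d}) = 1"
  defines "q \<equiv> real CARD('a)" and "N \<equiv> real CARD('a ^ 'n)"
  shows "3 * (N - q ^ 2) \<le> (N - q ^ 3) * F p S + (q ^ 3 - q ^ 2) * F p UNIV"
proof -
  have "real (card (UNIV - S)) * 3 \<le> (\<Sum>v\<in>UNIV - S. F p (vec.span (insert v S)))"
  proof (rule sum_bounded_below)
    fix v assume v: "v \<in> UNIV - S"
    have "S \<subseteq> vec.span (insert v S)"
      by (meson subset_insertI vec.span_superset order_trans)
    then show "3 \<le> F p (vec.span (insert v S))"
      using S d x v card_span_insert[OF S(1), of v]
      by (intro solid_sum_ge_3[where d = d]) (auto simp: power2_eq_square power3_eq_cube)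
  qed
  also have "\<dots> = (N - q ^ 2) * F p S + (q - 1) * q ^ 2 * (F p UNIV - F p S)"
    using sum_flat_sum_span_insert[of S UNIV f p] S by (simp add: N_def q_def)
  also have "real (card (UNIV - S)) = N - q ^ 2"
    using card_mono[of UNIV S] S by (simp add: card_Diff_subset of_nat_diff N_def q_def)
  finally show ?thesis by (simp add: algebra_simps power2_eq_square power3_eq_cube)
qed

lemma total_sum_ge:
  assumes n: "CARD('n) \<ge> 3" and x: "F p UNIV > 1"
  defines "q \<equiv> real CARD('a)"
  shows "F p UNIV \<ge> 2 * ((q ^ (CARD('n) - 1) - 1) / (q ^ 2 - 1)) + 1"
proof -
  define N where "N = real CARD('a ^ 'n)"
  define M where "M = q ^ (CARD('n) - 1)"
  define x where "x = F p UNIV"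
  have "CARD('a) > 1" by (rule card_field_gt_1)
  then have q: "q > 1" by (simp add: q_def)
  have N: "N = q * M"
    using n by (simp add: N_def M_def q_def flip: power_Suc)
  have "M > q ^ 1"
    unfolding M_def using n q by (intro power_strict_increasing) auto
  then have Nq: "N > q ^ 2" using q by (simp add: N power2_eq_square)
  \<comment> \<open>Any nonzero direction would do; the all-ones vector is a concrete one.\<close>
  define d :: "'a ^ 'n" where "d = 1"
  have d: "d \<noteq> 0" by (simp add: d_def)
  obtain a where a: "F a (vec.span {d}) = 1"
    using line_exists[OF vec.subspace_UNIV UNIV_I d, of p] assms by auto
  have ax: "F a UNIV = x" unfolding x_def by (rule flat_sum_cong_base) auto
  let ?T = "vec.span {d}"
  have T: "vec.subspace ?T" by simp
  have cardT: "real (card (UNIV - ?T)) = N - q"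
    using card_mono[of UNIV ?T] d
    by (simp add: card_Diff_subset of_nat_diff card_span_singleton N_def q_def)
  \<comment> \<open>The solid bound is summed over the planes through the chosen line of weight
    1.\<close>
  have "card (UNIV - ?T) * (3 * (N - q ^ 2)) \<le>
      (\<Sum>v\<in>UNIV - ?T. (N - q ^ 3) * F a (vec.span (insert v ?T)) + (q ^ 3 - q ^ 2) * x)"
  proof (rule sum_bounded_below)
    fix v assume v: "v \<in> UNIV - ?T"
    have "d \<in> vec.span (insert v ?T)"
      by (simp add: vec.span_base)
    then show "3 * (N - q ^ 2) \<le> (N - q ^ 3) * F a (vec.span (insert v ?T)) + (q ^ 3 - q ^ 2) * x"
      using v a d ax assms card_span_insert[OF T, of v]
        sum_plane_solids[of "vec.span (insert v ?T)" a d]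
      by (simp add: card_span_singleton power2_eq_square N_def x_def)
  qed
  also have "\<dots> = (N - q ^ 3) * (\<Sum>v\<in>UNIV - ?T. F a (vec.span (insert v ?T))) + (N - q) * (q ^ 3 - q ^ 2) * x"
    using cardT by (simp add: sum.distrib flip: sum_distrib_left)
  also have "(\<Sum>v\<in>UNIV - ?T. F a (vec.span (insert v ?T))) = (N - q) + (q - 1) * q * (x - 1)"
    using sum_flat_sum_span_insert[OF T vec.subspace_UNIV, of f a] a d ax
    by (simp add: card_span_singleton N_def q_def)
  \<comment> \<open>After writing \<open>x\<close> as \<open>1 + (x - 1)\<close>, both sides have
    the positive factor \<open>N - q ^ 2\<close>, which then cancels.\<close>
  finally have "(N - q ^ 2) * (2 * (N - q)) \<le> (N - q ^ 2) * (q * (q ^ 2 - 1) * (x - 1))"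
    unfolding cardT by (simp add: algebra_simps power2_eq_square power3_eq_cube)
  then have "2 * (N - q) \<le> q * (q ^ 2 - 1) * (x - 1)"
    using Nq by simp
  then have "q * (2 * (M - 1)) \<le> q * ((q ^ 2 - 1) * (x - 1))"
    by (simp add: N algebra_simps)
  then have "2 * (M - 1) \<le> (q ^ 2 - 1) * (x - 1)" using q by simp
  moreover have "q ^ 2 - 1 > 0" using q by (simp add: one_less_power)
  ultimately show ?thesis
    unfolding M_def[symmetric] x_def[symmetric] by (simp add: field_simps)
qed

end

section \<open>From line classes to point functions\<close>

lemma points_of_affine_line_of:
  assumes "d \<noteq> 0"
  shows "points_of (affine_line_of ((+) p ` vec.span {d})) = (+) p ` vec.span {d}"
proof (rule affine_line_of_inverse)
  have "(+) p ` vec.span {d} = {p + t *s d |t. True}"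
    by (auto simp: vec.span_singleton)
  with assms show "(+) p ` vec.span {d} \<in> {S. is_affine_line S}"
    by (auto simp: is_affine_line_def)
qed

lemma points_of_cases:
  obtains p d where "d \<noteq> 0" "points_of l = (+) p ` vec.span {d}"
proof -
  obtain p d where "d \<noteq> 0" "points_of l = {p + t *s d |t. True}"
    using points_of[of l] by (auto simp: is_affine_line_def)
  then show ?thesis by (intro that[of d p]) (auto simp: vec.span_singleton)
qed

text \<open>The coefficients of a combination of rows form a function on points. Accordingly, the
  vectors arising from point functions form a subspace containing each row, which comes from the
  indicator of its point.\<close>

lemma cameron_liebler_line_class_sum:
  fixes L :: "('a::{field,finite}, 'n::finite) affine_line set"
  assumes "cameron_liebler_line_class L"
  obtains f :: "'a ^ 'n \<Rightarrow> real" where "\<And>l. (\<Sum>p\<in>points_of l. f p) = (if l \<in> L then 1 else 0)"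
proof -
  let ?M = "incidence_matrix :: real ^ ('a, 'n) affine_line ^ ('a ^ 'n)"
  define V where "V = {v :: real ^ ('a, 'n) affine_line. \<exists>f. \<forall>l. v $ l = (\<Sum>p\<in>points_of l. f p)}"
  have "subspace V"
    unfolding V_def
  proof (rule subspaceI; clarsimp)
    show "\<exists>f. \<forall>l. (\<Sum>p\<in>points_of l. f p) = (0 :: real)"
      by (intro exI[of _ "\<lambda>_. 0"]) simp
    fix v w :: "real ^ ('a, 'n) affine_line" and f g
    assume "\<forall>l. v $ l = sum f (points_of l)" "\<forall>l. w $ l = sum g (points_of l)"
    then show "\<exists>h. \<forall>l. sum f (points_of l) + sum g (points_of l) = sum h (points_of l)"
      by (intro exI[of _ "\<lambda>p. f p + g p"]) (simp add: sum.distrib)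
  next
    fix c and f :: "'a ^ 'n \<Rightarrow> real"
    show "\<exists>h. \<forall>l. c * sum f (points_of l) = sum h (points_of l)"
      by (intro exI[of _ "\<lambda>p. c * f p"] allI sum_distrib_left)
  qed
  moreover have "rows ?M \<subseteq> V"
  proof
    fix v assume "v \<in> rows ?M"
    then obtain p where "v = row p ?M" by (auto simp: rows_def)
    then have "v $ l = (\<Sum>u\<in>points_of l. if u = p then 1 else 0)" for l
      by (simp add: row_def incidence_matrix_def)
    then show "v \<in> V" unfolding V_def by blast
  qed
  ultimately have "characteristic_vector L \<in> V"
    using assms span_minimal unfolding cameron_liebler_line_class_def by blast
  then show ?thesis
    by (auto simp: V_def characteristic_vector_def intro: that)
qed

text \<open>A line is described by any of its \<open>CARD('a)\<close> points together with any of
  the \<open>CARD('a) - 1\<close> nonzero vectors along it.\<close>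

lemma card_line_representations:
  fixes l :: "('a::{field,finite}, 'n::finite) affine_line"
  shows "card {(p, d). d \<noteq> 0 \<and> affine_line_of ((+) p ` vec.span {d}) = l} = CARD('a) * (CARD('a) - 1)"
proof -
  obtain a e where e: "e \<noteq> 0" and l: "points_of l = (+) a ` vec.span {e}"
    by (rule points_of_cases)
  have "{(p, d). d \<noteq> 0 \<and> affine_line_of ((+) p ` vec.span {d}) = l} = points_of l \<times> (vec.span {e} - {0})"
  proof (intro equalityI subsetI)
    fix z assume "z \<in> {(p, d). d \<noteq> 0 \<and> affine_line_of ((+) p ` vec.span {d}) = l}"
    then obtain p d where z: "z = (p, d)" and "d \<noteq> 0" "l = affine_line_of ((+) p ` vec.span {d})"
      by auto
    then have eq: "points_of l = (+) p ` vec.span {d}" by (simp add: points_of_affine_line_of)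
    have "p + 0 \<in> points_of l" "p + d \<in> points_of l"
      unfolding eq by (intro imageI vec.span_zero vec.span_base; simp)+
    then obtain u w where uw: "u \<in> vec.span {e}" "p = a + u" "w \<in> vec.span {e}" "p + d = a + w"
      unfolding l by auto
    then have "d = w - u" by (simp add: algebra_simps)
    with uw \<open>d \<noteq> 0\<close> \<open>p + 0 \<in> points_of l\<close>
    show "z \<in> points_of l \<times> (vec.span {e} - {0})"
      by (simp add: z vec.span_diff)
  next
    fix z assume "z \<in> points_of l \<times> (vec.span {e} - {0})"
    then obtain p d where z: "z = (p, d)" and p: "p \<in> points_of l" and d: "d \<in> vec.span {e}" "d \<noteq> 0"
      by auto
    obtain u where u: "u \<in> vec.span {e}" "p = a + u" using p l by auto
    have "(+) p ` vec.span {e} = points_of l"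
    proof (intro set_eqI iffI)
      fix x assume "x \<in> (+) p ` vec.span {e}"
      then obtain w where "w \<in> vec.span {e}" "x = a + (u + w)" using u by (auto simp: add.assoc)
      with u show "x \<in> points_of l" unfolding l by (intro image_eqI[of _ _ "u + w"] vec.span_add) auto
    next
      fix x assume "x \<in> points_of l"
      then obtain w where "w \<in> vec.span {e}" "x = p + (w - u)" using u l by auto
      with u show "x \<in> (+) p ` vec.span {e}" by (intro image_eqI[of _ _ "w - u"] vec.span_diff) auto
    qed
    then show "z \<in> {(p, d). d \<noteq> 0 \<and> affine_line_of ((+) p ` vec.span {d}) = l}"
      using d span_singleton_eq[of d e] by (simp add: z points_of_inverse)
  qed
  moreover have "card (points_of l) = CARD('a)"
    using e by (simp add: l card_image card_span_singleton)
  moreover have "card (vec.span {e} - {0}) = CARD('a) - 1"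
    using e by (simp add: card_Diff_subset card_span_singleton vec.span_zero)
  ultimately show ?thesis by (simp add: card_cartesian_product)
qed

text \<open>The pairs of a base point and a nonzero direction that describe a line of
  \<open>L\<close> are counted twice: by lines, and by directions, where each direction contributes
  \<open>CARD('a)\<close> times the total weight.\<close>

lemma parameter_eq_total_sum:
  fixes L :: "('a::{field,finite}, 'n::finite) affine_line set"
  assumes f: "\<And>l. (\<Sum>p\<in>points_of l. f p) = (if l \<in> L then 1 else 0)"
    and x: "has_parameter L x"
  shows "x = flat_sum f 0 UNIV"
proof -
  let ?l = "\<lambda>p (d :: 'a ^ 'n). affine_line_of ((+) p ` vec.span {d})"
  let ?R = "\<lambda>l. {(p, d). d \<noteq> 0 \<and> ?l p d = l}"
  have "CARD('a) > 1" by (rule card_field_gt_1)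
  then have q: "real CARD('a) > 1" by simp
  have N: "real CARD('a) ^ CARD('n) > 1" using q by (simp add: one_less_power)
  have "real CARD('a) * (real CARD('a) - 1) * card L = (\<Sum>l\<in>L. real (card (?R l)))"
    using q by (simp only: card_line_representations) (simp add: of_nat_diff Suc_leI)
  also have "\<dots> = card (\<Union>l\<in>L. ?R l)"
    by (subst card_UN_disjoint) auto
  also have "(\<Union>l\<in>L. ?R l) = {z \<in> (UNIV :: ('a ^ 'n) set) \<times> (UNIV - {0 :: 'a ^ 'n}). ?l (fst z) (snd z) \<in> L}"
    by auto
  also have "real (card \<dots>) = (\<Sum>z\<in>(UNIV :: ('a ^ 'n) set) \<times> (UNIV - {0 :: 'a ^ 'n}). if ?l (fst z) (snd z) \<in> L then 1 else 0)"
    by (simp add: sum.If_cases Int_def)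
  also have "\<dots> = (\<Sum>z\<in>(UNIV :: ('a ^ 'n) set) \<times> (UNIV - {0 :: 'a ^ 'n}). flat_sum f (fst z) (vec.span {snd z}))"
  proof (rule sum.cong[OF refl])
    fix z :: "('a ^ 'n) \<times> ('a ^ 'n)" assume "z \<in> (UNIV :: ('a ^ 'n) set) \<times> (UNIV - {0 :: 'a ^ 'n})"
    then have "(\<Sum>u\<in>points_of (?l (fst z) (snd z)). f u) = flat_sum f (fst z) (vec.span {snd z})"
      by (cases z) (simp add: points_of_affine_line_of flat_sum_def sum.reindex)
    then show "(if ?l (fst z) (snd z) \<in> L then 1 else 0) = flat_sum f (fst z) (vec.span {snd z})"
      by (simp add: f)
  qed
  also have "\<dots> = (\<Sum>d\<in>UNIV - {0}. \<Sum>p\<in>UNIV. flat_sum f p (vec.span {d}))"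
    by (subst sum.swap) (simp add: sum.cartesian_product case_prod_beta)
  also have "\<dots> = (\<Sum>d\<in>UNIV - {0 :: 'a ^ 'n}. real CARD('a) * flat_sum f 0 UNIV)"
    using sum_flat_sum[OF vec.subspace_UNIV subset_UNIV, of f 0]
    by (intro sum.cong refl) (simp add: card_span_singleton)
  also have "\<dots> = (real CARD('a) ^ CARD('n) - 1) * (real CARD('a) * flat_sum f 0 UNIV)"
    by (simp add: card_Diff_subset of_nat_diff Suc_leI)
  finally have "(real CARD('a) - 1) * card L = (real CARD('a) ^ CARD('n) - 1) * flat_sum f 0 UNIV"
    using q by simp
  then show ?thesis
    using x q less_imp_neq[OF N, symmetric] by (simp add: has_parameter_def)
qed

theorem theorem9p2:
  fixes L :: "('a::{field,finite}, 'n::finite) affine_line set"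
    and x :: real and n q :: nat
  assumes "n = CARD('n)" and "q = CARD('a)"
    and "n \<ge> 4"
    and "cameron_liebler_line_class L"
    and "has_parameter L x"
  shows "x \<in> {0, 1} \<or> x \<ge> 2 * ((real q ^ (n - 1) - 1) / (real q ^ 2 - 1)) + 1"
proof -
  obtain f :: "'a ^ 'n \<Rightarrow> real" where f: "\<And>l. (\<Sum>p\<in>points_of l. f p) = (if l \<in> L then 1 else 0)"
    using cameron_liebler_line_class_sum assms(4) by blast
  interpret line_indicator f
  proof
    fix p d :: "'a ^ 'n" assume "d \<noteq> 0"
    then have "flat_sum f p (vec.span {d}) = (\<Sum>u\<in>points_of (affine_line_of ((+) p ` vec.span {d})). f u)"
      by (simp add: points_of_affine_line_of flat_sum_def sum.reindex)
    then show "flat_sum f p (vec.span {d}) \<in> {0, 1}" by (simp add: f)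
  qed
  have x: "x = F 0 UNIV"
    using parameter_eq_total_sum[OF f assms(5)] .
  \<comment> \<open>Integrality, obtained here with the all-ones vector as direction, leaves only 0
    and 1 when \<open>x \<le> 1\<close>.\<close>
  have "x \<in> \<nat>"
    unfolding x by (rule flat_sum_Nats[of _ 1]) auto
  then obtain k where k: "x = real k" by (auto elim: Nats_cases)
  show ?thesis
  proof (cases "x > 1")
    case True
    then show ?thesis
      using total_sum_ge[of 0] assms x by simp
  next
    case False
    with k have "k = 0 \<or> k = 1" by auto
    with k show ?thesis by auto
  qed
qed

end
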